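(* Let $G$ be a maximal $\{C_3,C_5\}$-free graph on $n$ vertices with minimum degree $\delta(G)>n/5$. Then every vertex of $G$ has a neighbour in every $7$-cycle of $G$.
   Context: $C_\ell$ is the cycle of length $\ell$. A graph is maximal $\{C_3,C_5\}$-free if it contains no triangle and no 5-cycle as a subgraph, but adding any edge between two non-adjacent vertices creates a triangle or a 5-cycle. *)

theory Defs
  imports "Graph_Theory.Graph_Theory"
begin

text \<open>Finite simple graphs are rendered by the locale predicate \<^const>\<open>pair_graph\<close>: an
  undirected edge between u and v is the pair of arcs (u, v) and (v, u), so the degree of a
  vertex is its out-degree.\<close>

definition min_degree :: "'a pair_pre_digraph \<Rightarrow> nat" where
  "min_degree G = Min (out_degree (with_proj G) ` pverts G)"

text \<open>The library's \<^const>\<open>pre_digraph.cycle\<close> is a nonempty closed walk, given as a list of arcs,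
  that repeats no vertex except for the coinciding endpoints. It also admits length 2 (an edge
  traversed back and forth), hence the bound below. The vertices of the cycle are the tails of
  its arcs.\<close>

definition is_cycle_of_length :: "'a pair_pre_digraph \<Rightarrow> nat \<Rightarrow> ('a \<times> 'a) list \<Rightarrow> bool" where
  "is_cycle_of_length G l p \<longleftrightarrow> l \<ge> 3 \<and> pre_digraph.cycle (with_proj G) p \<and> length p = l"

definition cycle_verts :: "('a \<times> 'a) list \<Rightarrow> 'a set" where
  "cycle_verts p = fst ` set p"

definition cycles_free :: "nat set \<Rightarrow> 'a pair_pre_digraph \<Rightarrow> bool" where
  "cycles_free L G \<longleftrightarrow> \<not> (\<exists>l\<in>L. \<exists>p. is_cycle_of_length G l p)"

definition add_edge :: "'a \<Rightarrow> 'a \<Rightarrow> 'a pair_pre_digraph \<Rightarrow> 'a pair_pre_digraph" where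
  "add_edge u v G = G\<lparr>parcs := parcs G \<union> {(u, v), (v, u)}\<rparr>"

definition maximal_cycles_free :: "nat set \<Rightarrow> 'a pair_pre_digraph \<Rightarrow> bool" where
  "maximal_cycles_free L G \<longleftrightarrow> cycles_free L G \<and>
     (\<forall>u\<in>pverts G. \<forall>v\<in>pverts G. u \<noteq> v \<and> (u, v) \<notin> parcs G \<longrightarrow> \<not> cycles_free L (add_edge u v G))"

end

theory Submission
  imports Defs
begin

text \<open>Let W2 and W3 denote being joined by a walk of length 2 and 3. Since the graph has no closed walk
  of length 3 or 5, W2 and W3 exclude each other, and by maximality two vertices are nonadjacent
  exactly if they are joined by a walk of length 4. The degree condition says that among any \<open>5 * k\<close>
  vertices, repetitions allowed, more than \<open>k\<close> have a common neighbour. In particular these are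
  pairwise in relation W2.

  One should think of the vertices as points on a circle of length 1, adjacent if their distance
  exceeds 2/5. Then W2 means distance less than 1/5 and W3 means distance greater than 1/5, and a
  nonadjacent pair joined by a walk of length 3 lies on a 7-cycle, which winds around the circle in
  one of two directions. The degree condition forces enough of this picture: W2 has no induced
  square and no induced claw (with W3 in place of the negation of W2), every 6-cycle has a long chord,
  and overlapping 7-cycles wind in the same direction. If a vertex \<open>v\<close> has no neighbour on a
  7-cycle, then we may take it at distance 2 from the cycle, and the 7-cycles that arise from the
  nonadjacent pairs around the path from \<open>v\<close> to the given cycle cannot all wind consistently.

  All these statements concern boundedly many vertices, so their proofs are propositional. The
  instances passed to \<open>sat\<close> are small unsatisfiable sets found by computer search.\<close>

section \<open>Walks of length 2 and 3, and cliques of the relation \<open>W2\<close>\<close>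

locale five_dense =
  fixes E :: "'a \<Rightarrow> 'a \<Rightarrow> bool"
  assumes E_sym: "E x y = E y x"
    and no5: "\<not> (E a b \<and> E b c \<and> E c d \<and> E d e \<and> E e a)"
    and walk4: "E x y \<or> (\<exists>a b c. E x a \<and> E a b \<and> E b c \<and> E c y)"
    and heavy: "length xs = 5 * k \<Longrightarrow> 0 < k \<Longrightarrow> \<exists>x. k < length (filter (E x) xs)"
begin

definition W2 where "W2 x y \<longleftrightarrow> (\<exists>z. E x z \<and> E z y)"

definition W3 where "W3 x y \<longleftrightarrow> (\<exists>p q. E x p \<and> E p q \<and> E q y)"

lemma W2_sym: "W2 x y = W2 y x"
  unfolding W2_def by (metis E_sym)

lemma W3_sym: "W3 x y = W3 y x"
  unfolding W3_def by (metis E_sym)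

lemma W2I: "E x y \<longrightarrow> E y z \<longrightarrow> W2 x z"
  unfolding W2_def by blast

lemma W3I: "E x y \<longrightarrow> W2 y z \<longrightarrow> W3 x z"
  unfolding W2_def W3_def by blast

lemma E_W3: "E x y \<longrightarrow> W3 x y"
  unfolding W3_def using E_sym by blast

text \<open>The two walks together form a closed walk of length 5. \<open>no5\<close> allows
  repeated vertices, so degenerate walks are covered as well.\<close>

lemma W3_not_W2: "W3 x y \<longrightarrow> \<not> W2 x y"
  unfolding W2_def W3_def using no5 E_sym by blast

text \<open>Defined by recursion so that, for an explicit list, \<open>simp\<close> expands it into
  a propositional formula in atoms \<open>W2\<close>. It chooses \<open>k\<close> positions of
  \<open>xs\<close>; \<open>ys\<close> accumulates the entries chosen so far.\<close>

fun W2_clique :: "nat \<Rightarrow> 'a list \<Rightarrow> 'a list \<Rightarrow> bool" where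
  "W2_clique 0 ys xs = True"
| "W2_clique (Suc k) ys [] = False"
| "W2_clique (Suc k) ys (x # xs) =
     ((\<forall>y\<in>set ys. W2 y x) \<and> W2_clique k (x # ys) xs \<or> W2_clique (Suc k) ys xs)"

text \<open>Choose the entries adjacent to \<open>x\<close>: any two of them are joined by a walk of
  length 2 through \<open>x\<close>.\<close>

lemma W2_cliqueI:
  assumes "k \<le> length (filter (E x) xs)" "\<forall>y\<in>set ys. E x y"
  shows "W2_clique k ys xs"
  using assms
proof (induction k ys xs rule: W2_clique.induct)
  case (3 k ys y xs)
  then show ?case
    using W2I[of _ x y] E_sym by (cases "E x y") auto
qed auto

lemma heavy_W2_clique:
  assumes "length xs = 5 * k" "0 < k"
  shows "W2_clique (Suc k) [] xs"
proof -
  obtain x where "k < length (filter (E x) xs)"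
    using heavy[OF assms] by blast
  then show ?thesis
    by (intro W2_cliqueI[of _ x]) auto
qed

lemma five_W2:
  "W2 a b \<or> W2 a c \<or> W2 a d \<or> W2 a e \<or> W2 b c \<or> W2 b d \<or> W2 b e \<or> W2 c d \<or> W2 c e \<or> W2 d e"
  using heavy_W2_clique[of "[a, b, c, d, e]" 1] by auto

section \<open>Induced squares of \<open>W2\<close> and long chords of 6-cycles\<close>

text \<open>In the circle picture, four steps shorter than 1/5 cannot wind around. If
  \<open>p\<close> and \<open>q\<close> are more than 1/5 apart, the steps from \<open>p\<close>
  over \<open>b\<close> to \<open>q\<close> go one way and those over \<open>e\<close> back to
  \<open>p\<close> the other way. So the steps from \<open>b\<close> to \<open>q\<close> and from
  \<open>q\<close> to \<open>e\<close> partly cancel, and \<open>b\<close> and \<open>e\<close> are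
  close.\<close>

lemma W2_square: "W2 p b \<longrightarrow> W2 b q \<longrightarrow> W2 q e \<longrightarrow> W2 e p \<longrightarrow> W3 p q \<longrightarrow> \<not> W3 b e"
proof (intro impI notI)
  assume "W2 p b" "W2 b q" "W2 q e" "W2 e p" "W3 p q" "W3 b e"
  then obtain a c d f g h i j where edges:
    "E p a" "E a b" "E b c" "E c q" "E q d" "E d e" "E e f" "E f p" "E p g" "E g h" "E h q"
    "E b i" "E i j" "E j e"
    unfolding W2_def W3_def by blast
  \<comment> \<open>Three of the ten listed vertices are pairwise in relation \<open>W2\<close>. The
    pairs missing from the disjunction contain no triangle, so one of the named pairs is in relation
    \<open>W2\<close>. \<open>cut1\<close> is built in the same way.\<close>
  have cut0:
    "W2 b g \<or> W2 b e \<or> W2 b h \<or> W2 b f \<or> W2 b c \<or> W2 e g \<or>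
     W2 h i \<or> W2 e h \<or> W2 g j \<or> W2 c g \<or> W2 i j \<or> W2 f h \<or>
     W2 e f \<or> W2 f i \<or> W2 c e \<or> W2 p g \<or> W2 c j \<or> W2 p i \<or>
     W2 p j \<or> W2 q h \<or> W2 q i \<or> W2 p c \<or> W2 q j \<or> W2 q f \<or> W2 p q"
    using heavy_W2_clique[of "[p, b, c, q, e, f, g, h, i, j]" 2]
    by (rule_tac ccontr) (simp add: eval_nat_numeral)
  have cut1:
    "W2 p d \<or> W2 d g \<or> W2 b d \<or> W2 d i \<or> W2 q d \<or> W2 e g \<or>
     W2 p a \<or> W2 b g \<or> W2 p i \<or> W2 g i \<or> W2 b e \<or> W2 a e \<or>
     W2 b i \<or> W2 p q \<or> W2 p j \<or> W2 a q \<or> W2 e j \<or> W2 g h \<or>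
     W2 q i \<or> W2 a j \<or> W2 e h \<or> W2 b h \<or> W2 a h \<or> W2 q j \<or> W2 h j"
    using heavy_W2_clique[of "[p, a, b, q, d, e, g, h, i, j]" 2]
    by (rule_tac ccontr) (simp add: eval_nat_numeral)
  show False
    using edges cut0 cut1
      E_sym[of a p] E_sym[of q h] W2_sym[of g q] E_sym[of b a] W2_sym[of e i] W2_sym[of e c]
      E_sym[of e j] E_sym[of j i] W2_sym[of i h] W3_sym[of j h] W2_sym[of j g] W3_sym[of c d]
      E_sym[of d q] E_sym[of p f] W2_sym[of f b] W3_sym[of g i] W2_sym[of i d] W3_sym[of j d]
      E_sym[of h g] W3_sym[of p j] W3_sym[of e a] E_sym[of i b] W3_sym[of i e] W3_sym[of p d]
      W2_sym[of i q] W2_sym[of q b] W3_sym[of d b] W3_sym[of d h] E_sym[of f e] W2_sym[of e q]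
      W3_sym[of f q] W2I[of p g h] W2I[of q d e] W2I[of i j e] W2I[of a p g] W2I[of f p g]
      W2I[of b c q] W2I[of c q h] W2I[of g h q] W2I[of c q d] W2I[of p a b] W2I[of d e j]
      W2I[of e f p] W2I[of a b c] W2I[of h q d] W2I[of f p a] W2I[of a b i] W2I[of b i j]
      W3I[of j e p] W3I[of c q g] W3I[of b c j] W3I[of b c h] W3I[of e f i] W3I[of p a c]
      W3I[of b a q] W3I[of a p h] W3I[of d e c] W3I[of d e p] W3I[of j i h] W3I[of b a j]
      W3I[of i j g] W3I[of e f g] W3I[of d q j] W3I[of p a i] W3I[of p f b] W3I[of j i d]
      W3I[of d q g] W3I[of h g j] W3I[of e f a] W3I[of i b e] W3I[of b a g] W3I[of b i q]
      W3I[of d q b] W3I[of f p h] W3I[of g h i] W3I[of p g q] W3I[of d e h] W3I[of f e q]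
      E_W3[of p g] E_W3[of i j] E_W3[of e j] E_W3[of q d] E_W3[of g h] E_W3[of q h]
      E_W3[of b i] E_W3[of b c] E_W3[of e f] E_W3[of p a] W3_not_W2[of q h] W3_not_W2[of e j]
      W3_not_W2[of h j] W3_not_W2[of g h] W3_not_W2[of b g] W3_not_W2[of f h] W3_not_W2[of q d]
      W3_not_W2[of p a] W3_not_W2[of b d] W3_not_W2[of p i] W3_not_W2[of b j] W3_not_W2[of e g]
      W3_not_W2[of a e] W3_not_W2[of e i] W3_not_W2[of p b] W3_not_W2[of p g] W3_not_W2[of d j]
      W3_not_W2[of b i] W3_not_W2[of p q] W3_not_W2[of b q] W3_not_W2[of c d] W3_not_W2[of b c]
      W3_not_W2[of a h] W3_not_W2[of g i] W3_not_W2[of p j] W3_not_W2[of c g] W3_not_W2[of p d]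
      W3_not_W2[of d g] W3_not_W2[of p c] W3_not_W2[of q f] W3_not_W2[of b h] W3_not_W2[of h d]
      W3_not_W2[of i j] W3_not_W2[of e f]
    by sat
qed

text \<open>In the circle picture each edge deviates from a half turn by less than 1/10, and the
  deviations around the cycle sum to 0. The sum over three consecutive edges changes by less than
  1/5 per shift and is negated after three shifts, so it is below 1/10 in absolute value for some
  triple, whose ends are then adjacent.\<close>

lemma six_cycle_chord:
  assumes cycle: "E w0 w1" "E w1 w2" "E w2 w3" "E w3 w4" "E w4 w5" "E w5 w0"
  shows "E w0 w3 \<or> E w1 w4 \<or> E w2 w5"
proof (rule ccontr)
  assume nonadj: "\<not> (E w0 w3 \<or> E w1 w4 \<or> E w2 w5)"
  obtain a b c where path0: "E w0 a" "E a b" "E b c" "E c w3"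
    using walk4[of w0 w3] nonadj by blast
  obtain d e f where path1: "E w1 d" "E d e" "E e f" "E f w4"
    using walk4[of w1 w4] nonadj by blast
  obtain g h i where path2: "E w2 g" "E g h" "E h i" "E i w5"
    using walk4[of w2 w5] nonadj by blast
  note paths = path0 path1 path2
  \<comment> \<open>Four of the fifteen vertices are pairwise in relation \<open>W2\<close>, and the
    pairs missing from the disjunction contain no clique of size four.\<close>
  have cut0:
    "W2 w1 h \<or> W2 w4 h \<or> W2 b h \<or> W2 w3 h \<or> W2 w4 d \<or> W2 w5 d \<or>
     W2 w3 d \<or> W2 w0 h \<or> W2 w1 b \<or> W2 w4 b \<or> W2 e h \<or> W2 w3 w4 \<or>
     W2 w5 b \<or> W2 w0 w1 \<or> W2 w4 g \<or> W2 w2 w5 \<or> W2 d i \<or> W2 w2 b \<or>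
     W2 w1 f \<or> W2 d e \<or> W2 w5 g \<or> W2 w2 g \<or> W2 w1 i \<or> W2 w4 a \<or>
     W2 w2 f \<or> W2 w0 g \<or> W2 w3 a \<or> W2 w5 i \<or> W2 w5 e \<or> W2 w2 a \<or>
     W2 f g \<or> W2 w3 i \<or> W2 b e \<or> W2 w3 e \<or> W2 w2 i \<or> W2 w2 e \<or>
     W2 w0 f \<or> W2 a g \<or> W2 w0 a \<or> W2 w0 e \<or> W2 a f \<or> W2 e f \<or>
     W2 c d \<or> W2 w1 c \<or> W2 w5 c \<or> W2 c g \<or> W2 w0 c \<or> W2 c f \<or>
     W2 c i"
    using heavy_W2_clique[of "[w0, w1, w2, w3, w4, w5, a, b, c, d, e, f, g, h, i]" 3]
    by (rule_tac ccontr) (simp add: eval_nat_numeral)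
  show False
    using cycle paths cut0
      W2_sym[of w5 w3] W2_sym[of f a] W2_sym[of i d] W2_sym[of w1 e] W2_sym[of c w4]
      E_sym[of w4 f] E_sym[of d w1] E_sym[of e d] W3_sym[of e w2] E_sym[of h g] W3_sym[of h w1]
      E_sym[of w4 w3] W2_sym[of w3 g] W2_sym[of f w1] W2_sym[of w2 h] E_sym[of f e]
      W3_sym[of f w1] E_sym[of g w2] W2_sym[of f w5] W3_sym[of e w5] E_sym[of w0 w5]
      W2_sym[of w5 h] W2_sym[of w5 w1] E_sym[of a w0] E_sym[of w5 i] W3_sym[of w5 g]
      W2_sym[of w0 d] W2_sym[of h w3] W2_sym[of e w4] W2_sym[of d w4] W3_sym[of w4 e]
      W3_sym[of a w2] W2_sym[of b w3] W3_sym[of w3 e] W3_sym[of w4 h] E_sym[of w5 w4]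
      W2_sym[of f w2] W3_sym[of w4 w2] W2_sym[of a w4] W2_sym[of g i] W2_sym[of w1 g]
      E_sym[of c b] W2_sym[of b w0] W3_sym[of c w0] W3_sym[of c w5] W3_sym[of w5 w2]
      E_sym[of w1 w0] W3_sym[of b w4] W2_sym[of e w2] W3_sym[of w2 i] W3_sym[of w0 d]
      E_sym[of w3 c] W2_sym[of c a] W2_sym[of w4 w0] W2_sym[of c w2] W3_sym[of b w2]
      W3_sym[of i w1] W3_sym[of w3 d] W2_sym[of w3 w1] W3_sym[of c w1] W3_sym[of w0 e]
      W2I[of w1 d e] W2I[of c w3 w4] W2I[of w3 w4 f] W2I[of i w5 w0] W2I[of d w1 w2]
      W2I[of w2 g h] W2I[of g w2 w3] W2I[of w5 w0 w1] W2I[of a w0 w1] W2I[of w0 w1 d]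
      W2I[of w1 w2 w3] W2I[of w0 a b] W2I[of h i w5] W2I[of w2 w3 w4] W2I[of b c w3]
      W2I[of a b c] W2I[of e f w4] W2I[of w5 w0 a] W2I[of w4 w5 i] W2I[of g h i]
      W2I[of w4 w5 w0] W2I[of w2 w3 c] W2I[of w3 w4 w5] W2I[of f w4 w5] W2I[of w1 w2 g]
      W2I[of w0 w1 w2] W3I[of d w1 w3] W3I[of c w3 f] W3I[of e d w2] W3I[of h g w1]
      W3I[of w4 w3 g] W3I[of e f w1] W3I[of f e w1] W3I[of c w3 g] W3I[of e f w5]
      W3I[of w0 w5 h] W3I[of h g w3] W3I[of w5 i g] W3I[of e d w0] W3I[of g h w3]
      W3I[of d e w4] W3I[of e d w4] W3I[of a w0 w2] W3I[of w0 w5 f] W3I[of w4 w5 h]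
      W3I[of w5 w4 h] W3I[of w4 f w2] W3I[of w0 a w4] W3I[of w0 w1 g] W3I[of c b w0]
      W3I[of w3 w4 e] W3I[of c w3 w5] W3I[of w5 w0 w2] W3I[of w1 w0 b] W3I[of b c w4]
      W3I[of w5 w0 b] W3I[of d e w2] W3I[of w0 w5 d] W3I[of w3 c a] W3I[of b c w2]
      W3I[of w3 w4 i] W3I[of i w5 w1] W3I[of c w3 w1] W3I[of w2 g i] E_W3[of w2 g]
      E_W3[of w0 w1] E_W3[of d e] E_W3[of w5 i] E_W3[of w0 a] E_W3[of e f] E_W3[of w3 w4]
      W3_not_W2[of w5 e] W3_not_W2[of w0 h] W3_not_W2[of w1 h] W3_not_W2[of w0 f]
      W3_not_W2[of e w1] W3_not_W2[of w2 g] W3_not_W2[of w5 c] W3_not_W2[of d w0]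
      W3_not_W2[of w0 g] W3_not_W2[of w0 c] W3_not_W2[of e f] W3_not_W2[of w2 b]
      W3_not_W2[of w1 c] W3_not_W2[of w2 w4] W3_not_W2[of w5 i] W3_not_W2[of w5 b]
      W3_not_W2[of w2 a] W3_not_W2[of w1 i] W3_not_W2[of w4 e] W3_not_W2[of w2 w5]
      W3_not_W2[of w3 a] W3_not_W2[of w3 e] W3_not_W2[of w1 b] W3_not_W2[of w0 w1]
      W3_not_W2[of w5 h] W3_not_W2[of w0 a] W3_not_W2[of w5 g] W3_not_W2[of g w3]
      W3_not_W2[of w4 b] W3_not_W2[of w4 g] W3_not_W2[of d w2] W3_not_W2[of c f]
      W3_not_W2[of c g] W3_not_W2[of w3 w4] W3_not_W2[of w3 i] W3_not_W2[of w2 i]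
      W3_not_W2[of d e] W3_not_W2[of w3 d] W3_not_W2[of w0 e] W3_not_W2[of w0 w4]
      W2_square[of e w1 w3 b] W2_square[of g w3 w5 a] W2_square[of g w1 w5 f]
      W2_square[of i w0 w2 c] W2_square[of h w5 w3 b] W2_square[of d w0 w4 c]
      W2_square[of h w2 w4 e] W2_square[of w1 w3 f a] W2_square[of i d w2 w4]
    by sat
qed

text \<open>The three midpoints complete \<open>x\<close>, \<open>y\<close>, \<open>z\<close> to a
  6-cycle, and a long chord joins one of the three to the midpoint of the other two. The quantifier
  stands outside the implications so that \<open>obtain\<close> yields a propositional fact for
  \<open>sat\<close> without a case distinction.\<close>

lemma W2_triangle: "\<exists>m. W2 x y \<longrightarrow> W2 y z \<longrightarrow> W2 x z \<longrightarrow> E x m \<and> E y m \<and> E z m"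
proof (cases "W2 x y \<and> W2 y z \<and> W2 x z")
  case True
  then obtain p q r where "E x p" "E p y" "E y q" "E q z" "E z r" "E r x"
    unfolding W2_def using E_sym by metis
  with six_cycle_chord[of x p y q z r] show ?thesis
    using E_sym by metis
qed auto

section \<open>Overlapping 7-cycles and the claw\<close>

text \<open>The closed 7-walks \<open>x0 x1 x2 x3 c b a\<close> and \<open>x1 x2 x3 x4 f e d\<close>
  overlap in \<open>x1 x2 x3\<close>. They are 7-cycles, since a repeated vertex would split off a
  shorter odd closed walk, against \<open>no5\<close>. They coincide if \<open>x4 = c\<close>,
  \<open>f = b\<close>, \<open>e = a\<close> and \<open>d = x0\<close>, so \<open>a\<close> and
  \<open>e\<close> take corresponding places, and \<open>W3 a e\<close> would mean opposite
  windings.\<close>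

lemma coherent_shift:
  assumes edges: "E x0 x1" "E x1 x2" "E x2 x3" "E x3 x4" "E x0 a" "E a b" "E b c" "E c x3" "E x1 d" "E d e"
    "E e f" "E f x4"
  shows "\<not> W3 a e"
proof
  assume other: "W3 a e"
  \<comment> \<open>\<open>W2 x3 b\<close> and \<open>W2 x3 f\<close> hold through \<open>c\<close>
    and \<open>x4\<close>, so \<open>m\<close> is available as soon as \<open>W2 b f\<close>
    holds.\<close>
  obtain m where m: "W2 x3 b \<longrightarrow> W2 b f \<longrightarrow> W2 x3 f \<longrightarrow> E x3 m \<and> E b m \<and> E f m"
    using W2_triangle by blast
  show False
    using edges other m
      W2_sym[of f a] W2_sym[of e x1] W3_sym[of x3 e] W2_sym[of a m] W2_sym[of x3 x1]
      E_sym[of a x0] E_sym[of x2 x1] E_sym[of x4 f] E_sym[of x3 m] E_sym[of x1 x0]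
      W2_sym[of b x3] W2_sym[of e x4] W2_sym[of a x2] E_sym[of f e] W2_sym[of x4 x2]
      W3_sym[of f x2] W2I[of a b m] W2I[of a x0 x1] W2I[of x1 x2 x3] W2I[of x3 x4 f]
      W2I[of x2 x3 x4] W2I[of x1 d e] W2I[of x0 x1 x2] W2I[of e f x4] W2I[of x0 a b]
      W2I[of b c x3] W2I[of e f m] W3I[of x3 x4 e] W3I[of m x3 x1] W3I[of x2 x3 b]
      W3I[of x2 x1 e] W3I[of x1 x0 b] W3I[of a b x3] W3I[of x0 a x2] W3I[of f e x1]
      W3I[of f x4 x2] E_W3[of a b] E_W3[of e f] W3_not_W2[of x2 b] W3_not_W2[of a e]
      W3_not_W2[of x2 e] W3_not_W2[of e f] W3_not_W2[of a b] W3_not_W2[of x2 f]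
      W3_not_W2[of x0 x2] W2_square[of m a x1 e] W2_square[of f a x1 x3]
      W2_square[of e x1 x3 b] five_W2[of x2 a b e f]
    by sat
qed

text \<open>Now the 7-cycles \<open>x0 x1 x2 x3 c b a\<close> and \<open>x0 x1 x2 y3 f e d\<close>
  begin with the same two edges, and \<open>b\<close> and \<open>e\<close> take corresponding
  places.\<close>

lemma coherent_end_middle:
  assumes edges: "E x0 x1" "E x1 x2" "E x2 x3" "E x2 y3" "E x0 a" "E a b" "E b c" "E c x3" "E x0 d" "E d e"
    "E e f" "E f y3"
  shows "\<not> W3 b e"
proof
  assume other: "W3 b e"
  obtain m where m: "W2 x2 c \<longrightarrow> W2 c f \<longrightarrow> W2 x2 f \<longrightarrow> E x2 m \<and> E c m \<and> E f m"
    using W2_triangle by blast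
  show False
    using edges other m
      W2_sym[of f b] W2_sym[of x0 e] W3_sym[of x2 b] W2_sym[of b x3] W2_sym[of b m]
      E_sym[of m x2] W2_sym[of x2 x0] W2_sym[of f x2] W3_sym[of x0 f] W2_sym[of x0 b]
      E_sym[of y3 f] E_sym[of x1 x0] E_sym[of x3 c] E_sym[of c b] W3_sym[of c x0]
      W2I[of x0 x1 x2] W2I[of b c x3] W2I[of x0 d e] W2I[of b c m] W2I[of d e f]
      W2I[of x2 y3 f] W2I[of x0 a b] W2I[of x2 x3 c] W2I[of e f m] W3I[of x1 x2 f]
      W3I[of x2 x3 b] W3I[of m x2 x0] W3I[of e f x2] W3I[of x0 d f] W3I[of x0 x1 b]
      W3I[of x1 x2 c] W3I[of x1 x0 e] W3I[of c b x0] E_W3[of e f] E_W3[of b c]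
      W3_not_W2[of b c] W3_not_W2[of x1 c] W3_not_W2[of x1 e] W3_not_W2[of x1 f]
      W3_not_W2[of x0 b] W3_not_W2[of b e] W3_not_W2[of e f] W2_square[of e x0 x2 c]
      W2_square[of f b x0 x2] W2_square[of m b x0 e] five_W2[of x1 b c e f]
    by sat
qed

text \<open>The same two 7-cycles, compared at the places next to \<open>x3\<close> and
  \<open>y3\<close>. The auxiliary vertex \<open>m\<close> is now a neighbour of \<open>x0\<close>
  rather than of \<open>x2\<close>.\<close>

lemma coherent_end_last:
  assumes edges: "E x0 x1" "E x1 x2" "E x2 x3" "E x2 y3" "E x0 a" "E a b" "E b c" "E c x3" "E x0 d" "E d e"
    "E e f" "E f y3"
  shows "\<not> W3 c f"
proof
  assume other: "W3 c f"
  obtain m where m: "W2 x0 b \<longrightarrow> W2 b e \<longrightarrow> W2 x0 e \<longrightarrow> E x0 m \<and> E b m \<and> E e m"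
    using W2_triangle by blast
  show False
    using edges other m
      W2_sym[of e c] W2_sym[of f x2] E_sym[of c b] W2_sym[of b x0] W2_sym[of x0 x2]
      E_sym[of b m] E_sym[of y3 f] W2_sym[of x2 c] E_sym[of x3 x2] E_sym[of f e]
      W2_sym[of e x0] E_sym[of x0 m] E_sym[of x1 x0] W2_sym[of x3 b] W2I[of m b c]
      W2I[of b c x3] W2I[of x2 y3 f] W2I[of x0 d e] W2I[of x0 a b] W2I[of c x3 x2]
      W2I[of x0 x1 x2] W2I[of f e m] W3I[of c b x0] W3I[of m x0 x2] W3I[of x1 x2 c]
      W3I[of e f x2] W3I[of f e x0] W3I[of x0 x1 b] W3I[of x1 x0 e] W3I[of x2 x3 b]
      W3I[of x1 x2 f] E_W3[of e f] E_W3[of b c] W3_not_W2[of x1 f] W3_not_W2[of c f]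
      W3_not_W2[of x1 c] W3_not_W2[of x0 b] W3_not_W2[of e f] W3_not_W2[of b c]
      W3_not_W2[of x1 e] W2_square[of m c x2 f] W2_square[of e c x2 x0] W2_square[of f x2 x0 b]
      five_W2[of x1 b c e f]
    by sat
qed

text \<open>In the circle picture two of the three points lie on the same side of \<open>b\<close>,
  both within 1/5 of it, and so are less than 1/5 apart.\<close>

lemma W2_claw: "W2 b x \<longrightarrow> W2 b y \<longrightarrow> W2 b z \<longrightarrow> W3 x y \<longrightarrow> W3 y z \<longrightarrow> \<not> W3 z x"
proof (intro impI notI)
  assume "W2 b x" "W2 b y" "W2 b z" "W3 x y" "W3 y z" "W3 z x"
  then obtain a c d p q r t g h where edges:
    "E b a" "E a x" "E b c" "E c y" "E b d" "E d z" "E x p" "E p q" "E q y" "E y r" "E r t"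
    "E t z" "E z g" "E g h" "E h x"
    unfolding W2_def W3_def by blast
  \<comment> \<open>\<open>W2 x q\<close> and \<open>W2 x g\<close> hold through \<open>p\<close>
    and \<open>h\<close>, so only \<open>W2 q g\<close> is at stake.\<close>
  obtain m where m: "W2 x q \<longrightarrow> W2 q g \<longrightarrow> W2 x g \<longrightarrow> E x m \<and> E q m \<and> E g m"
    using W2_triangle by blast
  show False
    using edges m
      W2_sym[of b y] E_sym[of h g] W2_sym[of g a] W3_sym[of h a] W2_sym[of b x] E_sym[of x h]
      W2_sym[of h z] W2_sym[of x q] W2_sym[of x g] E_sym[of x m] E_sym[of q p] E_sym[of q m]
      E_sym[of y q] W3_sym[of y x] E_sym[of a b] E_sym[of g z] W2_sym[of z b] W3_sym[of a q]
      W2_sym[of a p] W2I[of m q y] W2I[of r t z] W2I[of b a x] W2I[of z g h] W2I[of b c y]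
      W2I[of g h x] W2I[of x p q] W2I[of z g m] W2I[of a x h] W2I[of a x p] W2I[of b d z]
      W3I[of y r z] W3I[of h g a] W3I[of m x b] W3I[of x h z] W3I[of q p a] W3I[of y q x]
      W3I[of a b z] W3I[of a b y] W3I[of g z b] W3I[of q y b] E_W3[of z g] E_W3[of y q]
      W3_not_W2[of a h] W3_not_W2[of a z] W3_not_W2[of y z] W3_not_W2[of a y] W3_not_W2[of y q]
      W3_not_W2[of a q] W3_not_W2[of z g] W2_square[of q x b z] W2_square[of m y b z]
      W2_square[of g x b y] five_W2[of a y z q g]
    by sat
qed

section \<open>Vertices at distance 2 from a 7-cycle\<close>

text \<open>Replacing \<open>v1\<close> by \<open>u\<close> gives the 7-cycle
  \<open>v0 u v2 v3 v4 v5 v6\<close>. Each of the three nonadjacent pairs is also joined by a path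
  of length 3 through \<open>u\<close>, so it lies on a 7-cycle through \<open>v\<close>. These
  windings cannot all agree.\<close>

lemma no_pendant_path_double:
  assumes cycle: "E v0 v1" "E v1 v2" "E v2 v3" "E v3 v4" "E v4 v5" "E v5 v6" "E v6 v0"
    and pendant: "E v u" "E u v0" "E u v2"
    and nonadj: "\<not> E v v1" "\<not> E v v6" "\<not> E v v3"
  shows False
proof -
  obtain a b c where path0: "E v a" "E a b" "E b c" "E c v1"
    using walk4[of v v1] nonadj by blast
  obtain d e f where path1: "E v d" "E d e" "E e f" "E f v6"
    using walk4[of v v6] nonadj by blast
  obtain g h i where path2: "E v g" "E g h" "E h i" "E i v3"
    using walk4[of v v3] nonadj by blast
  note paths = path0 path1 path2
  note edges = cycle pendant paths
  \<comment> \<open>\<open>r3\<close>, \<open>r5\<close>, \<open>r6\<close> and \<open>r7\<close>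
    compare the cycle through \<open>v0 u v2\<close> with a 7-cycle through \<open>v\<close>; the
    other four compare two 7-cycles through \<open>v\<close>.\<close>
  have r0: "\<not> W3 f c"
    by (rule coherent_end_last[of v u v0 v6 v1 d e f a b c]; use edges in \<open>simp add: E_sym\<close>)
  have r1: "\<not> W3 i c"
    by (rule coherent_end_last[of v u v2 v3 v1 g h i a b c]; use edges in \<open>simp add: E_sym\<close>)
  have r2: "\<not> W3 h b"
    by (rule coherent_end_middle[of v u v2 v3 v1 g h i a b c]; use edges in \<open>simp add: E_sym\<close>)
  have r3: "\<not> W3 v6 g"
    by (rule coherent_end_last[of v3 v2 u v0 v v4 v5 v6 i h g]; use edges in \<open>simp add: E_sym\<close>)
  have r4: "\<not> W3 e b"
    by (rule coherent_end_middle[of v u v0 v6 v1 d e f a b c]; use edges in \<open>simp add: E_sym\<close>)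
  have r5: "\<not> W3 d v3"
    by (rule coherent_shift[of v u v0 v6 v5 d e f v2 v3 v4]; use edges in \<open>simp add: E_sym\<close>)
  have r6: "\<not> W3 v4 e"
    by (rule coherent_shift[of v5 v6 v0 u v v4 v3 v2 f e d]; use edges in \<open>simp add: E_sym\<close>)
  have r7: "\<not> W3 v5 h"
    by (rule coherent_end_middle[of v3 v2 u v0 v v4 v5 v6 i h g]; use edges in \<open>simp add: E_sym\<close>)
  show False
    using edges  r0 r1 r2 r3 r4 r5 r6 r7
      W2_sym[of v0 v] W2_sym[of v v2] W2_sym[of v6 v1] W2_sym[of v v5] W2_sym[of u v6]
      E_sym[of c b] W2_sym[of b v4] W3_sym[of c v4] W3_sym[of f i] W2_sym[of b v1]
      E_sym[of v3 i] E_sym[of e d] W2_sym[of d v1] W3_sym[of e v1] W2_sym[of h d]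
      W3_sym[of g d] W3_sym[of v0 e] W2_sym[of c v2] W3_sym[of e h] W2_sym[of a v5]
      W3_sym[of v v5] E_sym[of a v] W3_sym[of a e] E_sym[of u v] W2_sym[of d u] W2_sym[of a v0]
      E_sym[of v0 u] E_sym[of i h] W2_sym[of h e] E_sym[of v5 v4] W2_sym[of v4 v2]
      W3_sym[of v5 v2] W3_sym[of v3 i] W2_sym[of d b] W3_sym[of v5 v1] E_sym[of v2 v1]
      W2_sym[of h v3] E_sym[of v2 u] W2_sym[of v5 v0] W3_sym[of a h] W2_sym[of h v6]
      W2_sym[of v1 v3] W3_sym[of v5 i] E_sym[of v3 v2] E_sym[of b a] W2_sym[of a v1]
      W3_sym[of b v1] E_sym[of v0 v6] W2_sym[of v6 v2] E_sym[of v1 v0] W2_sym[of b v6]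
      E_sym[of v6 f] W2_sym[of f a] W3_sym[of v6 a] W2_sym[of e v6] W2_sym[of i v0]
      W3_sym[of h v0] W3_sym[of v2 e] W3_sym[of v c] W2_sym[of i v4] W3_sym[of v6 g]
      W2_sym[of f v4] W3_sym[of e v4] W2_sym[of d v5] W2_sym[of i a] W2_sym[of f v]
      W3_sym[of d v6] W2_sym[of i d] E_sym[of v6 v5] W3_sym[of v6 b] W3_sym[of v1 v2]
      W3_sym[of b e] W3_sym[of v0 u] W3_sym[of v e] W2_sym[of e u] W3_sym[of d u]
      W2_sym[of g v4] W2_sym[of v4 v6] E_sym[of f e] W2_sym[of e v] W2_sym[of f v5]
      W3_sym[of e v5] W2_sym[of a u] W2_sym[of d v4] W3_sym[of v0 v6] W3_sym[of v6 f]
      E_sym[of d v] W3_sym[of a v5] W2_sym[of h u] W3_sym[of g u] W2_sym[of i v5]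
      W3_sym[of h v5] W3_sym[of v3 v6] W2_sym[of a v4] W3_sym[of b v4] W2_sym[of i e]
      E_sym[of v4 v3] W2_sym[of h v1] W3_sym[of g v1] W2_sym[of b v3] W3_sym[of a v3]
      W3_sym[of f c] W3_sym[of i c] W3_sym[of h b] W3_sym[of v6 g] W3_sym[of e b]
      W3_sym[of d v3] W3_sym[of v4 e] W3_sym[of v5 h] W2I[of v a b] W2I[of b c v1]
      W2I[of v2 v3 i] W2I[of c v1 v2] W2I[of u v d] W2I[of v6 v0 u] W2I[of f v6 v0]
      W2I[of h i v3] W2I[of u v2 v3] W2I[of u v g] W2I[of g h i] W2I[of v5 v6 v0]
      W2I[of v1 v2 v3] W2I[of v0 u v2] W2I[of u v a] W2I[of e f v6] W2I[of v3 v4 v5]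
      W2I[of i v3 v4] W2I[of v g h] W2I[of v d e] W2I[of u v0 v1] W2I[of v5 v6 f]
      W2I[of v u v0] W2I[of v4 v5 v6] W2I[of v2 v3 v4] W2I[of a b c] W2I[of v u v2]
      W2I[of v6 v0 v1] W2I[of d v g] W3I[of c b v4] W3I[of f v6 i] W3I[of e d v1] W3I[of g h d]
      W3I[of e f h] W3I[of v a v5] W3I[of a v e] W3I[of u v2 v4] W3I[of e d u] W3I[of v a v0]
      W3I[of i h e] W3I[of v2 v3 h] W3I[of v5 v4 v2] W3I[of u v2 i] W3I[of e d b]
      W3I[of v5 v6 v1] W3I[of v2 v1 v4] W3I[of a b v1] W3I[of c v1 i] W3I[of v2 u v1]
      W3I[of u v0 d] W3I[of a v h] W3I[of v2 v1 b] W3I[of v1 v2 e] W3I[of g h v6]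
      W3I[of v5 v4 i] W3I[of v3 v2 d] W3I[of b a v1] W3I[of v0 v6 v2] W3I[of v1 v0 h]
      W3I[of c v1 f] W3I[of a b v6] W3I[of b a h] W3I[of v0 v1 b] W3I[of v6 f a] W3I[of h i v0]
      W3I[of v4 v5 e] W3I[of v2 v1 e] W3I[of v a c] W3I[of c b f] W3I[of e f v4] W3I[of v d v5]
      W3I[of v5 v4 v] W3I[of v6 f g] W3I[of v3 i a] W3I[of e f v] W3I[of d e v6]
      W3I[of v5 v4 h] W3I[of e f v0] W3I[of v3 i d] W3I[of c b i] W3I[of v0 v1 h]
      W3I[of v6 v5 b] W3I[of v g i] W3I[of d e u] W3I[of v0 u v3] W3I[of v g v4]
      W3I[of v1 v2 v] W3I[of v0 v6 v4] W3I[of f e v] W3I[of e f v5] W3I[of v2 u a]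
      W3I[of b a u] W3I[of e d v4] W3I[of d v b] W3I[of a v v5] W3I[of g h u] W3I[of h i v5]
      W3I[of v3 v4 v6] W3I[of b a v4] W3I[of h i e] W3I[of v4 v3 a] W3I[of g h v1]
      W3I[of a b v3] E_W3[of i v3] E_W3[of v a] E_W3[of v g] E_W3[of v3 v4] E_W3[of f v6]
      E_W3[of u v0] E_W3[of d e] E_W3[of v5 v6] E_W3[of v4 v5] E_W3[of v d] E_W3[of v6 v0]
      E_W3[of a b] E_W3[of h i] E_W3[of v0 v1] W3_not_W2[of d g] W3_not_W2[of v0 e]
      W3_not_W2[of v3 i] W3_not_W2[of v0 v3] W3_not_W2[of a b] W3_not_W2[of v4 v5]
      W3_not_W2[of v1 g] W3_not_W2[of v1 b] W3_not_W2[of u i] W3_not_W2[of v v0]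
      W3_not_W2[of v d] W3_not_W2[of v1 v] W3_not_W2[of v2 v5] W3_not_W2[of v0 v2]
      W3_not_W2[of u g] W3_not_W2[of v2 b] W3_not_W2[of v0 h] W3_not_W2[of v2 h]
      W3_not_W2[of v1 v5] W3_not_W2[of v0 v4] W3_not_W2[of h i] W3_not_W2[of u d]
      W3_not_W2[of v1 v2] W3_not_W2[of v a] W3_not_W2[of v0 u] W3_not_W2[of v0 v1]
      W3_not_W2[of v e] W3_not_W2[of v2 a] W3_not_W2[of v3 v4] W3_not_W2[of v0 b]
      W3_not_W2[of v5 v6] W3_not_W2[of v0 v6] W3_not_W2[of v2 v4] W3_not_W2[of v6 f]
      W3_not_W2[of v6 d] W3_not_W2[of v g] W3_not_W2[of v4 a] W3_not_W2[of d e]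
      W2_claw[of v6 b u v4] W2_claw[of v2 c v v4] W2_claw[of v6 i e u] W2_claw[of v h e v0]
      W2_claw[of v2 i f v] W2_claw[of v1 d b v6] W2_claw[of v0 i v5 v] W2_claw[of v h e v2]
      W2_claw[of v6 e a v1] W2_claw[of v e v2 v5] W2_claw[of u a v6 v3] W2_claw[of v3 h a v1]
      W2_claw[of v3 a v1 v5] five_W2[of v1 v4 v f g] five_W2[of v0 v3 v4 a b]
      five_W2[of v0 v3 a b i] five_W2[of v1 v4 v5 v d] five_W2[of v2 v5 v6 b d]
      five_W2[of v1 v2 a f h] five_W2[of v0 u e h i] five_W2[of v0 v6 b d i]
      five_W2[of v0 v6 d h i] five_W2[of v1 v4 v5 v a] five_W2[of v2 v6 a b f]
      five_W2[of v1 v2 d e h] five_W2[of v1 v5 d e i] five_W2[of v0 v1 v4 a h]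
    by sat
qed

text \<open>A 7-cycle through \<open>v u v0 v1\<close> is only known to share one edge with the
  given cycle, too little for the coherence lemmas. The nonadjacent pairs at \<open>u\<close> supply
  intermediate 7-cycles through \<open>u v0 v1 v2\<close> and \<open>u v0 v6 v5\<close>.\<close>

lemma no_pendant_path_single:
  assumes cycle: "E v0 v1" "E v1 v2" "E v2 v3" "E v3 v4" "E v4 v5" "E v5 v6" "E v6 v0"
    and pendant: "E v u" "E u v0"
    and nonadj: "\<not> E v v1" "\<not> E v v6" "\<not> E u v2" "\<not> E u v5"
  shows False
proof -
  obtain a b c where path0: "E v a" "E a b" "E b c" "E c v1"
    using walk4[of v v1] nonadj by blast
  obtain d e f where path1: "E v d" "E d e" "E e f" "E f v6"
    using walk4[of v v6] nonadj by blast
  obtain g h i where path2: "E u g" "E g h" "E h i" "E i v2"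
    using walk4[of u v2] nonadj by blast
  obtain j k l where path3: "E u j" "E j k" "E k l" "E l v5"
    using walk4[of u v5] nonadj by blast
  note paths = path0 path1 path2 path3
  note edges = cycle pendant paths
  \<comment> \<open>\<open>r0\<close>, \<open>r2\<close>, \<open>r3\<close> and \<open>r7\<close>
    compare the given cycle with the intermediate ones; \<open>r1\<close>, \<open>r5\<close>,
    \<open>r6\<close> and \<open>r8\<close> compare these with the cycles through \<open>v\<close>;
    \<open>r4\<close> compares the two cycles through \<open>v\<close>.\<close>
  have r0: "\<not> W3 v4 h"
    by (rule coherent_end_middle[of v2 v1 v0 v6 u v3 v4 v5 i h g]; use edges in \<open>simp add: E_sym\<close>)
  have r1: "\<not> W3 d k"
    by (rule coherent_shift[of v u v0 v6 v5 d e f j k l]; use edges in \<open>simp add: E_sym\<close>)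
  have r2: "\<not> W3 v5 g"
    by (rule coherent_end_last[of v2 v1 v0 v6 u v3 v4 v5 i h g]; use edges in \<open>simp add: E_sym\<close>)
  have r3: "\<not> W3 v3 k"
    by (rule coherent_shift[of v4 v5 v6 v0 u v3 v2 v1 l k j]; use edges in \<open>simp add: E_sym\<close>)
  have r4: "\<not> W3 b e"
    by (rule coherent_end_middle[of v u v0 v1 v6 a b c d e f]; use edges in \<open>simp add: E_sym\<close>)
  have r5: "\<not> W3 l e"
    by (rule coherent_shift[of v5 v6 v0 u v l k j f e d]; use edges in \<open>simp add: E_sym\<close>)
  have r6: "\<not> W3 a h"
    by (rule coherent_shift[of v u v0 v1 v2 a b c g h i]; use edges in \<open>simp add: E_sym\<close>)
  have r7: "\<not> W3 j v2"
    by (rule coherent_shift[of u v0 v6 v5 v4 j k l v1 v2 v3]; use edges in \<open>simp add: E_sym\<close>)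
  have r8: "\<not> W3 i b"
    by (rule coherent_shift[of v2 v1 v0 u v i h g c b a]; use edges in \<open>simp add: E_sym\<close>)
  \<comment> \<open>\<open>W2 v0 v2\<close> and \<open>W2 v0 v\<close> hold through
    \<open>v1\<close> and \<open>u\<close>, so \<open>m\<close> requires only
    \<open>W2 v2 v\<close>. Likewise \<open>n\<close> requires only \<open>W2 v5 v\<close>.\<close>
  obtain m where m: "W2 v0 v2 \<longrightarrow> W2 v2 v \<longrightarrow> W2 v0 v \<longrightarrow> E v0 m \<and> E v2 m \<and> E v m"
    using W2_triangle by blast
  obtain n where n: "W2 v0 v5 \<longrightarrow> W2 v5 v \<longrightarrow> W2 v0 v \<longrightarrow> E v0 n \<and> E v5 n \<and> E v n"
    using W2_triangle by blast
  show False
    using edges m n r0 r1 r2 r3 r4 r5 r6 r7 r8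
      W2_sym[of g v5] W2_sym[of a v6] W2_sym[of h v6] W2_sym[of v1 v6] W2_sym[of u v3]
      W2_sym[of v2 h] W2_sym[of v0 v2] W2_sym[of v0 v5] W3_sym[of v6 k] W2_sym[of e v2]
      W3_sym[of h v0] E_sym[of c b] W3_sym[of c v] E_sym[of v2 i] W2_sym[of v1 u]
      W2_sym[of l v3] E_sym[of d v] W2_sym[of i v6] E_sym[of v6 v5] W2_sym[of a v5]
      W3_sym[of v v5] E_sym[of g u] W3_sym[of d l] W2_sym[of l u] W2_sym[of v v0] E_sym[of u v]
      W2_sym[of v v6] W2_sym[of l n] E_sym[of i h] W3_sym[of i k] W3_sym[of v0 e]
      W2_sym[of k v5] W3_sym[of i j] E_sym[of v5 l] W2_sym[of l g] W2_sym[of f v0]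
      W2_sym[of k v2] E_sym[of v1 c] W3_sym[of v3 k] E_sym[of v2 v1] E_sym[of h g]
      E_sym[of v n] W2_sym[of l d] W3_sym[of k d] W2_sym[of i m] W3_sym[of v1 d] E_sym[of v6 f]
      W2_sym[of f u] W3_sym[of v6 u] W3_sym[of v5 i] W3_sym[of a i] W2_sym[of d v5]
      W2_sym[of l v] E_sym[of l k] W2_sym[of k d] E_sym[of b a] E_sym[of v0 u] W3_sym[of b i]
      W2_sym[of u v5] W3_sym[of g v5] W2_sym[of l i] W3_sym[of h k] W2_sym[of l h]
      W2_sym[of c v] W3_sym[of v2 v6] W2_sym[of b v5] W2_sym[of v5 v3] W2_sym[of v v3]
      W3_sym[of d v3] E_sym[of a v] W3_sym[of a l] E_sym[of v3 v2] E_sym[of j u]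
      W2_sym[of u v2] W2_sym[of h a] W3_sym[of l e] E_sym[of e d] W3_sym[of e h] W2_sym[of k e]
      W2_sym[of i v] W3_sym[of v2 v] W2_sym[of h d] W2_sym[of b v6] W2_sym[of g v1]
      W3_sym[of v2 j] W2_sym[of i v0] W2_sym[of b v1] E_sym[of m v] W2_sym[of c a]
      W3_sym[of v1 a] W2_sym[of v v1] W3_sym[of v6 a] W2_sym[of d b] W3_sym[of e b]
      W2_sym[of k h] W3_sym[of v1 h] W2_sym[of j l] E_sym[of n v0] E_sym[of v0 v6]
      W2_sym[of l v6] W2_sym[of i a] W3_sym[of h a] W2_sym[of c v0] W3_sym[of b v0]
      W3_sym[of a c] W2_sym[of v6 m] W3_sym[of l v0] W2_sym[of e v1] W2_sym[of a d]
      W3_sym[of u c] W3_sym[of v f] W2_sym[of l c] W3_sym[of v5 c] W2_sym[of d v2]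
      W2_sym[of d v6] W2_sym[of v b] W2_sym[of a v2] W3_sym[of u k] W3_sym[of i v6]
      W2_sym[of h v0] W2_sym[of k v1] W3_sym[of l v1] E_sym[of k j] W2_sym[of j d]
      W2_sym[of j v2] W3_sym[of k v2] W2_sym[of g d] W3_sym[of j v6] W2_sym[of d v0]
      W3_sym[of v v0] W3_sym[of v2 g] W3_sym[of v5 v1] W3_sym[of j h] W2_sym[of l v1]
      W3_sym[of k v1] W3_sym[of v4 h] W3_sym[of d k] W3_sym[of v5 g] W3_sym[of v3 k]
      W3_sym[of b e] W3_sym[of l e] W3_sym[of a h] W3_sym[of j v2] W3_sym[of i b] W2I[of a b c]
      W2I[of e f v6] W2I[of v u v0] W2I[of d e f] W2I[of v6 v0 v1] W2I[of l v5 n]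
      W2I[of k l v5] W2I[of n v d] W2I[of f v6 v0] W2I[of v0 v1 c] W2I[of v3 v4 v5]
      W2I[of i v2 m] W2I[of g h i] W2I[of v0 v1 v2] W2I[of g u v0] W2I[of d v a]
      W2I[of v1 v2 v3] W2I[of b c v1] W2I[of h i v2] W2I[of u v d] W2I[of m v d] W2I[of m v a]
      W2I[of v d e] W2I[of j k l] W2I[of n v0 v1] W2I[of u v0 v6] W2I[of l v5 v6]
      W2I[of u v0 v1] W2I[of v5 v6 v0] W2I[of v6 v0 m] W2I[of v a b] W2I[of u g h]
      W2I[of g u j] W2I[of u v a] W2I[of u j k] W3I[of c b v] W3I[of a b h] W3I[of v2 i l]
      W3I[of c v1 u] W3I[of k l v3] W3I[of d v f] W3I[of h i v6] W3I[of v6 v5 b] W3I[of d e v6]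
      W3I[of v a v5] W3I[of g u i] W3I[of d e l] W3I[of k l u] W3I[of u v v6] W3I[of i h k]
      W3I[of g h v2] W3I[of i v2 j] W3I[of v5 l g] W3I[of d v k] W3I[of j k v2] W3I[of v4 v5 h]
      W3I[of v2 v1 h] W3I[of h g v0] W3I[of k l d] W3I[of v1 v2 d] W3I[of v6 f u]
      W3I[of i v2 v0] W3I[of v5 v6 i] W3I[of a b i] W3I[of v d v5] W3I[of c v1 a]
      W3I[of v5 l v] W3I[of v1 v2 l] W3I[of l k d] W3I[of b a e] W3I[of v0 u k] W3I[of i v2 b]
      W3I[of b c i] W3I[of g u v5] W3I[of v5 l i] W3I[of h i k] W3I[of k l h] W3I[of b c v]
      W3I[of v2 v1 v6] W3I[of c b v5] W3I[of v6 v5 v3] W3I[of d v v3] W3I[of a v l]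
      W3I[of v3 v2 a] W3I[of j u v2] W3I[of i h a] W3I[of l v5 e] W3I[of u v0 a] W3I[of e d h]
      W3I[of l k e] W3I[of v2 i v] W3I[of i h d] W3I[of a b v6] W3I[of u g v1] W3I[of v5 l j]
      W3I[of v2 i v0] W3I[of v6 v5 i] W3I[of e f l] W3I[of v2 v3 v5] W3I[of v2 v1 j]
      W3I[of v1 c a] W3I[of v2 v3 f] W3I[of u v v1] W3I[of v6 v5 a] W3I[of e d b] W3I[of l k h]
      W3I[of d v v0] W3I[of v1 v2 h] W3I[of k l v6] W3I[of h i a] W3I[of b c v0]
      W3I[of l v5 v0] W3I[of v1 v2 v6] W3I[of d e v1] W3I[of b a d] W3I[of v d f]
      W3I[of v5 l c] W3I[of e f v0] W3I[of v d v2] W3I[of v2 i j] W3I[of e d v6] W3I[of v a v2]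
      W3I[of i h v6] W3I[of g h v0] W3I[of l k v1] W3I[of k j d] W3I[of k j v2] W3I[of u g d]
      W3I[of j u v6] W3I[of v d v0] W3I[of v5 v6 v1] W3I[of j u h] W3I[of k l v1] E_W3[of v u]
      E_W3[of u g] E_W3[of k l] E_W3[of v d] E_W3[of u j] E_W3[of d e] E_W3[of v2 i]
      E_W3[of h i] E_W3[of v5 v6] E_W3[of a b] E_W3[of v a] E_W3[of v1 v2] E_W3[of v5 l]
      W3_not_W2[of h i] W3_not_W2[of h j] W3_not_W2[of e v6] W3_not_W2[of k l]
      W3_not_W2[of v2 v0] W3_not_W2[of v0 l] W3_not_W2[of v5 v6] W3_not_W2[of d f]
      W3_not_W2[of v0 e] W3_not_W2[of v2 l] W3_not_W2[of g i] W3_not_W2[of v0 b]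
      W3_not_W2[of b v] W3_not_W2[of g v0] W3_not_W2[of v5 j] W3_not_W2[of v2 v5]
      W3_not_W2[of u v1] W3_not_W2[of v2 i] W3_not_W2[of v u] W3_not_W2[of v1 v2]
      W3_not_W2[of v5 i] W3_not_W2[of v2 h] W3_not_W2[of d e] W3_not_W2[of v0 v]
      W3_not_W2[of a b] W3_not_W2[of u j] W3_not_W2[of v5 l] W3_not_W2[of v1 d]
      W3_not_W2[of u g] W3_not_W2[of u d] W3_not_W2[of v0 k] W3_not_W2[of a c]
      W3_not_W2[of v d] W3_not_W2[of v1 v6] W3_not_W2[of u a] W3_not_W2[of u c]
      W3_not_W2[of v1 v5] W3_not_W2[of u k] W3_not_W2[of v6 j] W3_not_W2[of v2 g]
      W3_not_W2[of u v6] W3_not_W2[of v a] W2_square[of d a v6 v1] W2_square[of v e v2 v0]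
      W2_claw[of g j i v5] W2_claw[of m i a v6] W2_claw[of h k v6 v2] W2_claw[of v1 d v6 v3]
      W2_claw[of v6 l a v1] W2_claw[of v5 k i v0] W2_claw[of u a v6 v3] W2_claw[of v2 h e v0]
      W2_claw[of u k h v1] W2_claw[of v0 f v v2] W2_claw[of v2 l d v0] W2_claw[of m i d v6]
      W2_claw[of v0 v v2 v5] W2_claw[of v1 d v6 b] W2_claw[of v0 c v5 v] W2_claw[of n l d v1]
      W2_claw[of u k h v6] W2_claw[of v2 l h v0] five_W2[of v2 v5 v6 b d]
      five_W2[of v3 v u f l] five_W2[of v2 v5 v6 a b] five_W2[of v1 v2 v5 a e]
      five_W2[of v0 h i k l] five_W2[of v u c i l] five_W2[of v1 v2 v k l]
      five_W2[of v0 a b h i] five_W2[of v5 v6 h i j] five_W2[of v2 v5 u g l]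
      five_W2[of v1 v2 v5 v d] five_W2[of v2 v6 v a i] five_W2[of v1 v5 d h j]
      five_W2[of v2 v5 u i j] five_W2[of v1 v2 v5 v l] five_W2[of v1 v2 d g l]
      five_W2[of v0 d e k l] five_W2[of v1 v2 v5 d e]
    by sat
qed

text \<open>The cases are whether \<open>u\<close> is adjacent to \<open>v5\<close>, to
  \<open>v2\<close> or to neither. Reversing the cycle reduces the first to the second and exchanges
  \<open>v3\<close> with \<open>v4\<close>.\<close>

lemma no_pendant_path:
  assumes cycle: "E v0 v1" "E v1 v2" "E v2 v3" "E v3 v4" "E v4 v5" "E v5 v6" "E v6 v0"
    and pendant: "E v u" "E u v0"
    and nonadj: "\<not> E v v1" "\<not> E v v3" "\<not> E v v4" "\<not> E v v6"
  shows False
proof -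
  have "E v0 v6" "E v6 v5" "E v5 v4" "E v4 v3" "E v3 v2" "E v2 v1" "E v1 v0"
    using cycle E_sym by blast+
  then have "\<not> E u v5"
    using no_pendant_path_double[of v0 v6 v5 v4 v3 v2 v1 v u] pendant nonadj by blast
  moreover have "\<not> E u v2"
    using no_pendant_path_double[OF cycle pendant] nonadj by blast
  ultimately show False
    using no_pendant_path_single[OF cycle pendant] nonadj by blast
qed

text \<open>Rotate the cycle so that \<open>w\<close> becomes \<open>v0\<close>. It follows that the
  property of having a neighbour on the cycle passes to adjacent vertices.\<close>

lemma no_vertex_at_distance_2:
  assumes cycle: "E v0 v1" "E v1 v2" "E v2 v3" "E v3 v4" "E v4 v5" "E v5 v6" "E v6 v0"
    and u: "E v u" "w \<in> {v0, v1, v2, v3, v4, v5, v6}" "E u w"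
  shows "\<exists>w\<in>{v0, v1, v2, v3, v4, v5, v6}. E v w"
proof (rule ccontr)
  assume "\<not> ?thesis"
  then have n: "\<not> E v v0" "\<not> E v v1" "\<not> E v v2" "\<not> E v v3" "\<not> E v v4" "\<not> E v v5" "\<not> E v v6"
    by auto
  note rot = no_pendant_path[of v0 v1 v2 v3 v4 v5 v6 v u] no_pendant_path[of v1 v2 v3 v4 v5 v6 v0 v u]
    no_pendant_path[of v2 v3 v4 v5 v6 v0 v1 v u] no_pendant_path[of v3 v4 v5 v6 v0 v1 v2 v u]
    no_pendant_path[of v4 v5 v6 v0 v1 v2 v3 v u] no_pendant_path[of v5 v6 v0 v1 v2 v3 v4 v u]
    no_pendant_path[of v6 v0 v1 v2 v3 v4 v5 v u]
  show False
    using u(2,3) rot[OF _ _ _ _ _ _ _ u(1)] cycle n by blast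
qed

text \<open>Follow a walk of length 4 from \<open>v\<close> to \<open>v0\<close> backwards:
  \<open>r\<close> is adjacent to the cycle, and this property passes on to \<open>q\<close>,
  \<open>p\<close> and \<open>v\<close>.\<close>

lemma seven_cycle_dominating:
  assumes cycle: "E v0 v1" "E v1 v2" "E v2 v3" "E v3 v4" "E v4 v5" "E v5 v6" "E v6 v0"
  shows "\<exists>w\<in>{v0, v1, v2, v3, v4, v5, v6}. E v w"
proof (cases "E v v0")
  case False
  let ?C = "{v0, v1, v2, v3, v4, v5, v6}"
  obtain p q r where walk: "E v p" "E p q" "E q r" "E r v0"
    using False walk4[of v v0] by blast
  obtain w where "w \<in> ?C" "E q w"
    using no_vertex_at_distance_2[OF cycle walk(3) _ walk(4)] by blast
  then obtain w where "w \<in> ?C" "E p w"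
    using no_vertex_at_distance_2[OF cycle walk(2)] by blast
  then show ?thesis
    using no_vertex_at_distance_2[OF cycle walk(1)] by blast
qed blast

end

section \<open>Short cycles as explicit arc lists\<close>

lemmas cycle_unfold = is_cycle_of_length_def pre_digraph.cycle_def pre_digraph.awalk_def
  pre_digraph.cas.simps pre_digraph.awalk_verts.simps

lemma cycle_3I:
  assumes "distinct [a, b, c]" "a \<in> pverts G" "{(a, b), (b, c), (c, a)} \<subseteq> parcs G"
  shows "is_cycle_of_length G 3 [(a, b), (b, c), (c, a)]"
  using assms by (auto simp: cycle_unfold)

lemma cycle_5I:
  assumes "distinct [a, b, c, d, e]" "a \<in> pverts G" "{(a, b), (b, c), (c, d), (d, e), (e, a)} \<subseteq> parcs G"
  shows "is_cycle_of_length G 5 [(a, b), (b, c), (c, d), (d, e), (e, a)]"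
  using assms by (auto simp: cycle_unfold)

lemma cycle_3E:
  assumes "is_cycle_of_length G 3 p"
  obtains a b c where "distinct [a, b, c]" "{(a, b), (b, c), (c, a)} \<subseteq> parcs G"
proof -
  have "length p = 3"
    using assms by (simp add: is_cycle_of_length_def)
  then obtain x y z where "p = [x, y, z]"
    by (auto simp: numeral_eq_Suc length_Suc_conv)
  with assms have "distinct [fst x, fst y, fst z]" "{x, y, z} \<subseteq> parcs G"
    "snd x = fst y" "snd y = fst z" "snd z = fst x"
    by (auto simp: cycle_unfold)
  then show thesis
    using that[of "fst x" "fst y" "fst z"] by (metis prod.collapse)
qed

lemma cycle_5E:
  assumes "is_cycle_of_length G 5 p"
  obtains a b c d e where "distinct [a, b, c, d, e]" "{(a, b), (b, c), (c, d), (d, e), (e, a)} \<subseteq> parcs G"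
proof -
  have "length p = 5"
    using assms by (simp add: is_cycle_of_length_def)
  then obtain v w x y z where "p = [v, w, x, y, z]"
    by (auto simp: numeral_eq_Suc length_Suc_conv)
  with assms have "distinct [fst v, fst w, fst x, fst y, fst z]" "{v, w, x, y, z} \<subseteq> parcs G"
    "snd v = fst w" "snd w = fst x" "snd x = fst y" "snd y = fst z" "snd z = fst v"
    by (auto simp: cycle_unfold)
  then show thesis
    using that[of "fst v" "fst w" "fst x" "fst y" "fst z"] by (metis prod.collapse)
qed

lemma cycle_7E:
  assumes "is_cycle_of_length G 7 p"
  obtains a b c d e f g where "p = [(a, b), (b, c), (c, d), (d, e), (e, f), (f, g), (g, a)]" "set p \<subseteq> parcs G"
proof -
  have "length p = 7"
    using assms by (simp add: is_cycle_of_length_def)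
  then obtain t u v w x y z where p: "p = [t, u, v, w, x, y, z]"
    by (auto simp: numeral_eq_Suc length_Suc_conv)
  with assms have "set p \<subseteq> parcs G"
    "snd t = fst u" "snd u = fst v" "snd v = fst w" "snd w = fst x" "snd x = fst y" "snd y = fst z" "snd z = fst t"
    by (auto simp: cycle_unfold)
  then show thesis
    using p that[of "fst t" "fst u" "fst v" "fst w" "fst x" "fst y" "fst z"] by (metis prod.collapse)
qed

section \<open>Closed 5-walks and the use of maximality\<close>

context pair_graph
begin

lemma arc_sym: "(a, b) \<in> parcs G \<Longrightarrow> (b, a) \<in> parcs G"
  using pair_sym_arcs by (simp add: symmetric_def sym_def)

text \<open>A cycle with distinct vertices uses the new edge only once, so its other four edges lie
  in \<open>G\<close> and join \<open>x\<close> to \<open>y\<close>.\<close>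

lemma walk_through_added_edge:
  assumes cycle: "{(a, b), (b, c), (c, d), (d, e), (e, a)} \<subseteq> parcs (add_edge x y G)"
      "distinct [a, b, c, d, e]"
    and ab: "{a, b} = {x, y}"
  shows "\<exists>p q r. {(x, p), (p, q), (q, r), (r, y)} \<subseteq> parcs G"
proof -
  have kept: "(s, t) \<in> parcs G" if "(s, t) \<in> parcs (add_edge x y G)" "{s, t} \<noteq> {a, b}" for s t
    using that ab by (auto simp: add_edge_def)
  have "{b, c} \<noteq> {a, b}" "{c, d} \<noteq> {a, b}" "{d, e} \<noteq> {a, b}" "{e, a} \<noteq> {a, b}"
    using cycle(2) by (auto simp: doubleton_eq_iff)
  then have "{(b, c), (c, d), (d, e), (e, a)} \<subseteq> parcs G"
    using cycle(1) kept by simp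
  \<comment> \<open>Both orientations are listed because \<open>a\<close> may be either
    \<open>x\<close> or \<open>y\<close>.\<close>
  then have "{(b, c), (c, d), (d, e), (e, a), (a, e), (e, d), (d, c), (c, b)} \<subseteq> parcs G"
    using arc_sym by simp
  moreover have "x = a \<and> y = b \<or> x = b \<and> y = a"
    using ab by (auto simp: doubleton_eq_iff)
  ultimately show ?thesis
    by blast
qed

text \<open>If two vertices two steps apart coincide, the walk goes back and forth along an edge,
  and the remaining three edges form a triangle.\<close>

lemma no_closed_5_walk:
  assumes "cycles_free {3, 5} G"
  shows "\<not> {(a, b), (b, c), (c, d), (d, e), (e, a)} \<subseteq> parcs G"
proof
  assume walk: "{(a, b), (b, c), (c, d), (d, e), (e, a)} \<subseteq> parcs G"
  have irrefl: "s \<noteq> t" if "(s, t) \<in> parcs G" for s t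
    using pair_no_loops[OF that] by simp
  have fst_in: "s \<in> pverts G" if "(s, t) \<in> parcs G" for s t
    using arc_fst_in_verts[OF that] by simp
  have triangle: False if "{(x, y), (y, z), (z, x)} \<subseteq> parcs G" for x y z
  proof -
    have "distinct [x, y, z]" "x \<in> pverts G"
      using that irrefl fst_in by auto
    then have "is_cycle_of_length G 3 [(x, y), (y, z), (z, x)]"
      using that by (rule cycle_3I)
    with assms show False
      unfolding cycles_free_def by blast
  qed
  have "a \<noteq> b" "b \<noteq> c" "c \<noteq> d" "d \<noteq> e" "e \<noteq> a"
    using walk irrefl by auto
  then have "distinct [a, b, c, d, e] \<or> a = c \<or> b = d \<or> c = e \<or> d = a \<or> e = b"
    by auto
  then show False
  proof (elim disjE)
    assume "distinct [a, b, c, d, e]"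
    moreover have "a \<in> pverts G"
      using walk fst_in by auto
    ultimately have "is_cycle_of_length G 5 [(a, b), (b, c), (c, d), (d, e), (e, a)]"
      using walk by (rule cycle_5I)
    with assms show False
      unfolding cycles_free_def by blast
  next
    assume "a = c"
    then show False
      using walk triangle[of c d e] by simp
  next
    assume "b = d"
    then show False
      using walk triangle[of d e a] by simp
  next
    assume "c = e"
    then show False
      using walk triangle[of e a b] by simp
  next
    assume "d = a"
    then show False
      using walk triangle[of a b c] by simp
  next
    assume "e = b"
    then show False
      using walk triangle[of b c d] by simp
  qed
qed

lemma nonadjacent_walk:
  assumes max: "maximal_cycles_free {3, 5} G"
    and xy: "x \<in> pverts G" "y \<in> pverts G" "x \<noteq> y" "(x, y) \<notin> parcs G"
  shows "\<exists>p q r. {(x, p), (p, q), (q, r), (r, y)} \<subseteq> parcs G"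
proof -
  let ?H = "add_edge x y G"
  have free: "cycles_free {3, 5} G"
    using max by (simp add: maximal_cycles_free_def)
  obtain l p where "l = 3 \<or> l = 5" and p: "is_cycle_of_length ?H l p"
    using max xy unfolding maximal_cycles_free_def cycles_free_def by blast
  then show ?thesis
  proof (elim disjE)
    assume "l = 3"
    then obtain a b c where abc: "distinct [a, b, c]" "{(a, b), (b, c), (c, a)} \<subseteq> parcs ?H"
      using p cycle_3E by blast
    \<comment> \<open>Going once more back and forth along \<open>a b\<close> turns a triangle into
      a closed 5-walk.\<close>
    have "\<not> {(a, b), (b, c), (c, a)} \<subseteq> parcs G"
      using no_closed_5_walk[OF free, of a b c a b] arc_sym by blast
    then obtain z where "(x, z) \<in> parcs G" "(z, y) \<in> parcs G"
      using abc arc_sym by (auto simp: add_edge_def)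
    \<comment> \<open>The walk \<open>x z y\<close> left by the triangle is padded to length
      4.\<close>
    then have "{(x, z), (z, x), (x, z), (z, y)} \<subseteq> parcs G"
      using arc_sym by simp
    then show ?thesis
      by blast
  next
    assume "l = 5"
    then obtain a b c d e where cycle: "distinct [a, b, c, d, e]"
        "{(a, b), (b, c), (c, d), (d, e), (e, a)} \<subseteq> parcs ?H"
      using p cycle_5E by blast
    have added: "(s, t) \<in> parcs G \<or> {s, t} = {x, y}" if "(s, t) \<in> parcs ?H" for s t
      using that by (auto simp: add_edge_def)
    have "{a, b} = {x, y} \<or> {b, c} = {x, y} \<or> {c, d} = {x, y} \<or> {d, e} = {x, y} \<or> {e, a} = {x, y}"
      using cycle(2) no_closed_5_walk[OF free, of a b c d e]
        added[of a b] added[of b c] added[of c d] added[of d e] added[of e a]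
      by (simp only: insert_subset empty_subsetI simp_thms) argo
    then show ?thesis
    proof (elim disjE)
      show ?thesis if "{a, b} = {x, y}"
        by (rule walk_through_added_edge[OF _ _ that, of c d e]) (use cycle in auto)
      show ?thesis if "{b, c} = {x, y}"
        by (rule walk_through_added_edge[OF _ _ that, of d e a]) (use cycle in auto)
      show ?thesis if "{c, d} = {x, y}"
        by (rule walk_through_added_edge[OF _ _ that, of e a b]) (use cycle in auto)
      show ?thesis if "{d, e} = {x, y}"
        by (rule walk_through_added_edge[OF _ _ that, of a b c]) (use cycle in auto)
      show ?thesis if "{e, a} = {x, y}"
        by (rule walk_through_added_edge[OF _ _ that, of b c d]) (use cycle in auto)
    qed
  qed
qed

lemma out_degree_eq: "out_degree G v = card {w \<in> pverts G. (v, w) \<in> parcs G}"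
proof -
  have "bij_betw snd (out_arcs G v) {w \<in> pverts G. (v, w) \<in> parcs G}"
    by (rule bij_betw_byWitness[of _ "Pair v"]) (auto simp: out_arcs_def arc_snd_in_verts dest: arc_snd_in_verts)
  then show ?thesis
    unfolding out_degree_def by (rule bij_betw_same_card)
qed

end

section \<open>Double counting and the conclusion\<close>

text \<open>Both sides count the pairs of an \<open>x\<close> in \<open>V\<close> and a position of
  \<open>ys\<close> whose entry \<open>y\<close> satisfies \<open>P x y\<close>.\<close>

lemma sum_length_filter:
  assumes "finite V"
  shows "(\<Sum>x\<in>V. length (filter (P x) ys)) = (\<Sum>y\<leftarrow>ys. card {x \<in> V. P x y})"
proof (induction ys)
  case (Cons y ys)
  have "(\<Sum>x\<in>V. length (filter (P x) (y # ys))) = (\<Sum>x\<in>V. (if P x y then 1 else 0) + length (filter (P x) ys))"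
    by (rule sum.cong) auto
  also have "\<dots> = card {x \<in> V. P x y} + (\<Sum>x\<in>V. length (filter (P x) ys))"
    using assms by (simp add: sum.distrib flip: sum.inter_filter)
  finally show ?case
    using Cons by simp
qed simp

theorem theorem2p1:
  fixes G :: "'a pair_pre_digraph" and n :: nat
  assumes "pair_graph G"
    and "n = card (pverts G)"
    and "maximal_cycles_free {3, 5} G"
    and "real (min_degree G) > real n / 5"
  shows "\<forall>v\<in>pverts G. \<forall>p. is_cycle_of_length G 7 p \<longrightarrow>
           (\<exists>w\<in>cycle_verts p. (v, w) \<in> parcs G)"
proof (intro ballI allI impI)
  interpret pair_graph G by fact
  fix v p
  assume v: "v \<in> pverts G" and p: "is_cycle_of_length G 7 p"
  \<comment> \<open>Identifying the non-vertices with \<open>v\<close> gives a graph on the whole type, so the locale needs no carrier.\<close>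
  define f where "f x = (if x \<in> pverts G then x else v)" for x
  define E where "E x y \<longleftrightarrow> (f x, f y) \<in> parcs G" for x y
  have f: "f x \<in> pverts G" for x
    using v by (simp add: f_def)
  have f_id: "f x = x" if "x \<in> pverts G" for x
    using that by (simp add: f_def)
  have E_iff: "E x y \<longleftrightarrow> (x, y) \<in> parcs G" if "x \<in> pverts G" "y \<in> pverts G" for x y
    using that by (simp add: E_def f_id)
  have fst_in: "x \<in> pverts G" if "(x, y) \<in> parcs G" for x y
    using that arc_fst_in_verts[of "(x, y)"] by simp
  have lift: "\<exists>p q r. E x p \<and> E p q \<and> E q r \<and> E r y"
    if walk: "\<exists>p q r. {(f x, p), (p, q), (q, r), (r, f y)} \<subseteq> parcs G" for x y
  proof -
    obtain p q r where *: "{(f x, p), (p, q), (q, r), (r, f y)} \<subseteq> parcs G"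
      using walk by blast
    then have "f p = p" "f q = q" "f r = r"
      using fst_in f_id by blast+
    with * show ?thesis
      unfolding E_def by (intro exI[of _ p] exI[of _ q] exI[of _ r]) simp
  qed
  have degree: "n < 5 * card {x \<in> pverts G. (y, x) \<in> parcs G}" if "y \<in> pverts G" for y
  proof -
    have "min_degree G \<le> out_degree G y"
      unfolding min_degree_def using that pair_finite_verts by simp
    then show ?thesis
      using assms(4) unfolding out_degree_eq by linarith
  qed
  have nbr: "\<exists>z. (x, z) \<in> parcs G" if "x \<in> pverts G" for x
  proof -
    have "{z \<in> pverts G. (x, z) \<in> parcs G} \<noteq> {}"
      using degree[OF that] by (intro notI) simp
    then show ?thesis by blast
  qed
  interpret five_dense E
  proof
    show "E x y = E y x" for x y
      unfolding E_def using arc_sym by blast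
    show "\<not> (E a b \<and> E b c \<and> E c d \<and> E d e \<and> E e a)" for a b c d e
      unfolding E_def using no_closed_5_walk[of "f a" "f b" "f c" "f d" "f e"] assms(3)
      by (auto simp: maximal_cycles_free_def)
    show "E x y \<or> (\<exists>a b c. E x a \<and> E a b \<and> E b c \<and> E c y)" for x y
    proof (cases "f x = f y")
      \<comment> \<open>No loop is available here, so the walk goes twice back and forth to a
        neighbour, which exists because the degree is positive.\<close>
      case True
      obtain z where "(f x, z) \<in> parcs G"
        using nbr[OF f] by blast
      then have "{(f x, z), (z, f x), (f x, z), (z, f y)} \<subseteq> parcs G"
        using arc_sym True by simp
      then show ?thesis
        by (intro disjI2 lift) blast
    next
      case False
      have "E x y" if "(f x, f y) \<in> parcs G"
        using that by (simp add: E_def)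
      then show ?thesis
        using lift[OF nonadjacent_walk[OF assms(3) f f False]] by blast
    qed
    show "\<exists>x. k < length (filter (E x) ys)" if len: "length ys = 5 * k" and k: "0 < k" for ys k
    proof (rule ccontr)
      assume "\<not> ?thesis"
      then have le: "length (filter (E x) ys) \<le> k" for x
        by (simp add: not_less)
      have "card {x \<in> pverts G. E x y} = card {x \<in> pverts G. (f y, x) \<in> parcs G}" for y
        by (intro arg_cong[of _ _ card] Collect_cong) (auto simp: E_def f_id intro: arc_sym)
      then have "n < 5 * card {x \<in> pverts G. E x y}" for y
        using degree[OF f] by simp
      \<comment> \<open>\<open>Suc n\<close> records that the degree bound is strict: over 5 * k
        entries this gives 5 * k * (n + 1) \<le> 5 * n * k, which is impossible for positive
        \<open>k\<close>.\<close>
      then have "(\<Sum>y\<leftarrow>ys. Suc n) \<le> (\<Sum>y\<leftarrow>ys. 5 * card {x \<in> pverts G. E x y})"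
        by (intro sum_list_mono) (simp add: Suc_le_eq)
      also have "\<dots> = 5 * (\<Sum>x\<in>pverts G. length (filter (E x) ys))"
        using pair_finite_verts by (simp add: sum_length_filter sum_list_const_mult)
      also have "\<dots> \<le> 5 * (n * k)"
        using sum_bounded_above[of "pverts G" "\<lambda>x. length (filter (E x) ys)" k] le assms(2) by simp
      finally show False
        using len k by (simp add: sum_list_triv)
    qed
  qed
  from p obtain a b c d e g h where p_eq: "p = [(a, b), (b, c), (c, d), (d, e), (e, g), (g, h), (h, a)]"
      and arcs: "set p \<subseteq> parcs G"
    by (rule cycle_7E)
  have verts: "{a, b, c, d, e, g, h} \<subseteq> pverts G"
    using arcs fst_in unfolding p_eq by auto
  have "\<exists>w\<in>{a, b, c, d, e, g, h}. E v w"
    using arcs verts unfolding p_eq by (intro seven_cycle_dominating) (simp_all add: E_iff)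
  then show "\<exists>w\<in>cycle_verts p. (v, w) \<in> parcs G"
    using verts v E_iff unfolding cycle_verts_def p_eq by auto
qed

end
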